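(* Let $A$ be a separable C*-algebra and let $B\subseteq A$ be a closed *-subalgebra containing an approximate unit for $A$. Assume that $B$ is abelian. Then the range of every virtual commutant of $B$ in $A$ is contained in $B$ if and only if $B'\cap A\subseteq B$ (which is to say that $B$ is maximal abelian in $A$).
   Context: A virtual commutant of $B$ in $A$ is a linear map $\varphi:J\to A$ defined on a closed two-sided ideal $J$ of $B$ such that $\varphi(bx)=b\varphi(x)$ and $\varphi(xb)=\varphi(x)b$ for all $x\in J$ and $b\in B$. The relative commutant is $B'\cap A=\{a\in A: ab=ba\ \text{for all } b\in B\}$. *)

theory Defs
  imports "HOL-Analysis.Analysis"
begin

text \<open>
  A (not necessarily unital) C*-algebra is modelled as a type. The distribution has no class of
  complex algebras, so complex scalars are added to a real Banach algebra; the axiom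
  \<open>scaleC_of_real\<close> makes the complex structure extend the real one.
\<close>

class cstar_algebra = real_normed_algebra + banach +
  fixes scaleC :: "complex \<Rightarrow> 'a \<Rightarrow> 'a" (infixr \<open>*\<^sub>C\<close> 75)
    and star :: "'a \<Rightarrow> 'a"
  assumes scaleC_add_right: "c *\<^sub>C (x + y) = c *\<^sub>C x + c *\<^sub>C y"
    and scaleC_add_left: "(c + d) *\<^sub>C x = c *\<^sub>C x + d *\<^sub>C x"
    and scaleC_scaleC: "c *\<^sub>C d *\<^sub>C x = (c * d) *\<^sub>C x"
    and scaleC_of_real: "complex_of_real r *\<^sub>C x = r *\<^sub>R x"
    and mult_scaleC_left: "(c *\<^sub>C x) * y = c *\<^sub>C (x * y)"
    and mult_scaleC_right: "x * (c *\<^sub>C y) = c *\<^sub>C (x * y)"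
    and norm_scaleC: "norm (c *\<^sub>C x) = cmod c * norm x"
    and star_add: "star (x + y) = star x + star y"
    and star_scaleC: "star (c *\<^sub>C x) = cnj c *\<^sub>C star x"
    and star_mult: "star (x * y) = star y * star x"
    and star_star: "star (star x) = x"
    and cstar_identity: "norm (star x * x) = (norm x)\<^sup>2"

global_interpretation cvec: vector_space "scaleC :: complex \<Rightarrow> 'a \<Rightarrow> 'a::cstar_algebra"
proof
  fix x :: 'a
  show "1 *\<^sub>C x = x"
    using scaleC_of_real [of 1 x] by simp
qed (simp_all add: scaleC_add_right scaleC_add_left scaleC_scaleC)

definition closed_star_subalgebra :: "'a::cstar_algebra set \<Rightarrow> bool" where
  "closed_star_subalgebra B \<longleftrightarrow>
     cvec.subspace B \<and> closed B \<and>
     (\<forall>x\<in>B. \<forall>y\<in>B. x * y \<in> B) \<and> (\<forall>x\<in>B. star x \<in> B)"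

definition abelian :: "'a::cstar_algebra set \<Rightarrow> bool" where
  "abelian B \<longleftrightarrow> (\<forall>x\<in>B. \<forall>y\<in>B. x * y = y * x)"

definition directed_set :: "'i set \<Rightarrow> ('i \<Rightarrow> 'i \<Rightarrow> bool) \<Rightarrow> bool" where
  "directed_set I le \<longleftrightarrow>
     I \<noteq> {} \<and> (\<forall>i\<in>I. le i i) \<and>
     (\<forall>i\<in>I. \<forall>j\<in>I. \<forall>k\<in>I. le i j \<longrightarrow> le j k \<longrightarrow> le i k) \<and>
     (\<forall>i\<in>I. \<forall>j\<in>I. \<exists>k\<in>I. le i k \<and> le j k)"

definition net_filter :: "'i set \<Rightarrow> ('i \<Rightarrow> 'i \<Rightarrow> bool) \<Rightarrow> 'i filter" where
  "net_filter I le = (INF i\<in>I. principal {j\<in>I. le i j})"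

lemma eventually_net_filter:
  assumes "directed_set I le"
  shows "eventually P (net_filter I le) \<longleftrightarrow> (\<exists>i\<in>I. \<forall>j\<in>I. le i j \<longrightarrow> P j)"
proof -
  have "eventually P (net_filter I le) \<longleftrightarrow>
          (\<exists>i\<in>I. eventually P (principal {j\<in>I. le i j}))"
    unfolding net_filter_def
  proof (rule eventually_INF_base)
    show "I \<noteq> {}"
      using assms by (simp add: directed_set_def)
  next
    fix i j assume ij: "i \<in> I" "j \<in> I"
    then obtain k where "k \<in> I" "le i k" "le j k"
      using assms unfolding directed_set_def by blast
    with ij show "\<exists>k\<in>I. principal {l\<in>I. le k l} \<le>
                    inf (principal {l\<in>I. le i l}) (principal {l\<in>I. le j l})"
      using assms unfolding directed_set_def inf_principal principal_le_iff by blast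
  qed
  then show ?thesis
    by (auto simp: eventually_principal)
qed

text \<open>
  No norm bound, positivity or monotonicity is imposed on an approximate unit. The various
  conventions that do impose them give special cases of this definition.
\<close>

definition approximate_unit ::
    "'i set \<Rightarrow> ('i \<Rightarrow> 'i \<Rightarrow> bool) \<Rightarrow> ('i \<Rightarrow> 'a::cstar_algebra) \<Rightarrow> bool" where
  "approximate_unit I le u \<longleftrightarrow>
     directed_set I le \<and>
     (\<forall>a. ((\<lambda>i. u i * a) \<longlongrightarrow> a) (net_filter I le) \<and>
          ((\<lambda>i. a * u i) \<longlongrightarrow> a) (net_filter I le))"

definition closed_ideal_of :: "'a::cstar_algebra set \<Rightarrow> 'a set \<Rightarrow> bool" where
  "closed_ideal_of J B \<longleftrightarrow>
     J \<subseteq> B \<and> cvec.subspace J \<and> closed J \<and>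
     (\<forall>b\<in>B. \<forall>x\<in>J. b * x \<in> J \<and> x * b \<in> J)"

text \<open>
  A virtual commutant is a map on \<open>J\<close> only: \<open>\<phi>\<close> is a total function, but its values outside
  \<open>J\<close> are unconstrained, so its range is \<open>\<phi> ` J\<close>.
\<close>

definition virtual_commutant ::
    "'a::cstar_algebra set \<Rightarrow> 'a set \<Rightarrow> ('a \<Rightarrow> 'a) \<Rightarrow> bool" where
  "virtual_commutant B J \<phi> \<longleftrightarrow>
     closed_ideal_of J B \<and>
     (\<forall>x\<in>J. \<forall>y\<in>J. \<phi> (x + y) = \<phi> x + \<phi> y) \<and>
     (\<forall>c. \<forall>x\<in>J. \<phi> (c *\<^sub>C x) = c *\<^sub>C \<phi> x) \<and>
     (\<forall>x\<in>J. \<forall>b\<in>B. \<phi> (b * x) = b * \<phi> x \<and> \<phi> (x * b) = \<phi> x * b)"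

definition relative_commutant :: "'a::cstar_algebra set \<Rightarrow> 'a set" where
  "relative_commutant B = {a. \<forall>b\<in>B. a * b = b * a}"

definition maximal_abelian :: "'a::cstar_algebra set \<Rightarrow> bool" where
  "maximal_abelian B \<longleftrightarrow>
     closed_star_subalgebra B \<and> abelian B \<and>
     (\<forall>C. closed_star_subalgebra C \<and> abelian C \<and> B \<subseteq> C \<longrightarrow> C = B)"

end

theory Submission
  imports Defs
begin

text \<open>
  If \<open>B\<close> is abelian, then \<open>b \<phi>(x) = \<phi>(bx) = \<phi>(xb) = \<phi>(x) b\<close>, so virtual commutants take values in
  the relative commutant; conversely an element \<open>a\<close> of the relative commutant gives the virtual
  commutant \<open>x \<mapsto> ax\<close> on \<open>J = B\<close>, and \<open>a\<close> is the limit of the \<open>a u\<^sub>i\<close>. For a self-adjoint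
  \<open>h\<close> commuting with \<open>B\<close>, the double commutant of \<open>B \<union> {h}\<close> is an abelian closed *-subalgebra,
  so a maximal abelian \<open>B\<close> contains \<open>h\<close>; a general element is handled through its real and
  imaginary parts.
\<close>

text \<open>Commuting with a fixed \<open>b\<close> is a closed linear condition that is stable
  under products. Closure under \<open>star\<close> comes from taking adjoints in
  \<open>x * star b = star b * x\<close>. \<open>S\<close> is an arbitrary set so that the lemma
  also applies to \<open>insert h B\<close>, which need not be a subspace.\<close>

lemma closed_star_subalgebra_relative_commutant:
  fixes S :: "'a::cstar_algebra set"
  assumes "\<And>x. x \<in> S \<Longrightarrow> star x \<in> S"
  shows "closed_star_subalgebra (relative_commutant S)"
  unfolding closed_star_subalgebra_def
proof (intro conjI ballI)
  show "cvec.subspace (relative_commutant S)"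
    by (simp add: cvec.subspace_def relative_commutant_def distrib_left distrib_right
        mult_scaleC_left mult_scaleC_right)
  have "relative_commutant S = (\<Inter>b\<in>S. {a. a * b = b * a})"
    by (auto simp: relative_commutant_def)
  then show "closed (relative_commutant S)"
    by (auto intro!: closed_INT closed_Collect_eq continuous_intros)
next
  fix x y assume xy: "x \<in> relative_commutant S" "y \<in> relative_commutant S"
  have "x * y * b = b * (x * y)" if "b \<in> S" for b
  proof -
    have "x * b = b * x" "y * b = b * y"
      using xy that by (auto simp: relative_commutant_def)
    then show ?thesis
      by (metis mult.assoc)
  qed
  then show "x * y \<in> relative_commutant S"
    by (simp add: relative_commutant_def)
next
  fix x assume x: "x \<in> relative_commutant S"
  have "star x * b = b * star x" if "b \<in> S" for b
  proof -
    have "star (x * star b) = star (star b * x)"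
      using x assms [OF that] by (simp add: relative_commutant_def)
    then show ?thesis
      by (simp add: star_mult star_star)
  qed
  then show "star x \<in> relative_commutant S"
    by (simp add: relative_commutant_def)
qed

lemma subset_double_commutant: "S \<subseteq> relative_commutant (relative_commutant S)"
  by (auto simp: relative_commutant_def)

lemma abelian_iff_subset_commutant: "abelian S \<longleftrightarrow> S \<subseteq> relative_commutant S"
  by (auto simp: abelian_def relative_commutant_def)

lemma relative_commutant_antimono:
  "S \<subseteq> T \<Longrightarrow> relative_commutant T \<subseteq> relative_commutant S"
  by (auto simp: relative_commutant_def)

text \<open>Taking commutants reverses inclusions, so applying it twice to
  \<open>S \<subseteq> relative_commutant S\<close> gives the same inclusion for the double
  commutant.\<close>

lemma abelian_double_commutant:
  assumes "abelian S"
  shows "abelian (relative_commutant (relative_commutant S))"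
  using assms unfolding abelian_iff_subset_commutant by (intro relative_commutant_antimono)

lemma self_adjoint_mem_maximal_abelian:
  assumes B: "maximal_abelian B" and h: "h \<in> relative_commutant B" "star h = h"
  shows "h \<in> B"
proof -
  let ?S = "insert h B"
  let ?C = "relative_commutant (relative_commutant ?S)"
  have sub: "closed_star_subalgebra B" and "abelian B"
    using B by (auto simp: maximal_abelian_def)
  moreover have "h * b = b * h" if "b \<in> B" for b
    using h(1) that by (simp add: relative_commutant_def)
  ultimately have "abelian ?S"
    unfolding abelian_def by (metis insert_iff)
  then have "abelian ?C"
    by (rule abelian_double_commutant)
  \<comment> \<open>This is where \<open>star h = h\<close> enters: it makes \<open>?S\<close>
    closed under \<open>star\<close>.\<close>
  moreover have "closed_star_subalgebra (relative_commutant ?S)"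
    using sub h by (intro closed_star_subalgebra_relative_commutant)
      (auto simp: closed_star_subalgebra_def)
  then have "closed_star_subalgebra ?C"
    by (intro closed_star_subalgebra_relative_commutant) (simp add: closed_star_subalgebra_def)
  moreover have "?S \<subseteq> ?C"
    by (rule subset_double_commutant)
  ultimately show ?thesis
    using B unfolding maximal_abelian_def by (metis insert_subset)
qed

lemma relative_commutant_subset_maximal_abelian:
  assumes "maximal_abelian B"
  shows "relative_commutant B \<subseteq> B"
proof
  fix a assume a: "a \<in> relative_commutant B"
  have B: "cvec.subspace B" "\<And>x. x \<in> B \<Longrightarrow> star x \<in> B"
    using assms by (auto simp: maximal_abelian_def closed_star_subalgebra_def)
  have "closed_star_subalgebra (relative_commutant B)"
    by (intro closed_star_subalgebra_relative_commutant B)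
  then have C: "cvec.subspace (relative_commutant B)"
      "\<And>x. x \<in> relative_commutant B \<Longrightarrow> star x \<in> relative_commutant B"
    by (auto simp: closed_star_subalgebra_def)
  have real_part: "x + star x \<in> B" if "x \<in> relative_commutant B" for x
    using that C by (intro self_adjoint_mem_maximal_abelian [OF assms])
      (auto intro: cvec.subspace_add simp: star_add star_star add.commute)
  \<comment> \<open>The imaginary part of \<open>a\<close> is obtained from the real part of
    \<open>\<i> *\<^sub>C a\<close>, so \<open>real_part\<close> serves both summands. Since
    \<open>star (\<i> *\<^sub>C a) = - \<i> *\<^sub>C star a\<close>, the two \<open>star a\<close>
    terms cancel.\<close>
  have "(1/2) *\<^sub>C (a + star a) + (- \<i>/2) *\<^sub>C (\<i> *\<^sub>C a + star (\<i> *\<^sub>C a)) \<in> B"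
    using a B(1) C(1) by (intro cvec.subspace_add cvec.subspace_scale real_part)
  also have "(1/2) *\<^sub>C (a + star a) + (- \<i>/2) *\<^sub>C (\<i> *\<^sub>C a + star (\<i> *\<^sub>C a))
      = (1/2 + 1/2) *\<^sub>C a + (1/2 + - (1/2)) *\<^sub>C star a"
    unfolding star_scaleC scaleC_add_left scaleC_add_right scaleC_scaleC
    by (simp add: add_ac)
  also have "\<dots> = a"
    by simp
  finally show "a \<in> B" .
qed

lemma maximal_abelian_iff_relative_commutant_subset:
  assumes "closed_star_subalgebra B" "abelian B"
  shows "maximal_abelian B \<longleftrightarrow> relative_commutant B \<subseteq> B"
proof
  assume "relative_commutant B \<subseteq> B"
  \<comment> \<open>An abelian \<open>C\<close> lies in its own commutant, which shrinks as the set
    grows.\<close>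
  moreover have "C \<subseteq> relative_commutant B" if "abelian C" "B \<subseteq> C" for C
    using that abelian_iff_subset_commutant relative_commutant_antimono by blast
  ultimately show "maximal_abelian B"
    using assms by (auto simp: maximal_abelian_def)
qed (rule relative_commutant_subset_maximal_abelian)

lemma virtual_commutant_range_subset_relative_commutant:
  assumes "abelian B" "virtual_commutant B J \<phi>"
  shows "\<phi> ` J \<subseteq> relative_commutant B"
proof -
  have "\<phi> x * b = b * \<phi> x" if "x \<in> J" "b \<in> B" for x b
  proof -
    have "x \<in> B" "\<phi> (b * x) = b * \<phi> x" "\<phi> (x * b) = \<phi> x * b"
      using assms(2) that by (auto simp: virtual_commutant_def closed_ideal_of_def)
    moreover have "b * x = x * b"
      using assms(1) \<open>x \<in> B\<close> \<open>b \<in> B\<close> unfolding abelian_def by blast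
    ultimately show ?thesis
      by simp
  qed
  then show ?thesis
    by (auto simp: relative_commutant_def)
qed

lemma virtual_commutant_left_mult:
  assumes "closed_star_subalgebra B" "a \<in> relative_commutant B"
  shows "virtual_commutant B B (\<lambda>x. a * x)"
proof -
  have "a * (b * x) = b * (a * x)" if "b \<in> B" for b x
    using assms(2) that by (simp add: relative_commutant_def flip: mult.assoc)
  then show ?thesis
    using assms(1) by (auto simp: virtual_commutant_def closed_ideal_of_def
        closed_star_subalgebra_def distrib_left mult_scaleC_right mult.assoc)
qed

text \<open>By reflexivity each index lies in its own tail, so no tail is empty.\<close>

lemma net_filter_neq_bot:
  assumes "directed_set I le"
  shows "net_filter I le \<noteq> bot"
proof -
  have "I \<noteq> {}" "\<forall>i\<in>I. le i i"
    using assms by (auto simp only: directed_set_def)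
  then show ?thesis
    unfolding trivial_limit_def eventually_net_filter [OF assms] by blast
qed

lemma mem_if_mult_approximate_unit_mem:
  assumes u: "approximate_unit I le u" and "closed B" and au: "\<And>i. i \<in> I \<Longrightarrow> a * u i \<in> B"
  shows "a \<in> B"
proof (rule Lim_in_closed_set)
  have I: "directed_set I le"
    using u by (simp add: approximate_unit_def)
  then show "net_filter I le \<noteq> bot"
    by (rule net_filter_neq_bot)
  \<comment> \<open>The net stays in \<open>B\<close> throughout, so the tail of any one index is
    enough; one exists because \<open>I\<close> is nonempty.\<close>
  have "{j \<in> I. le i j} \<subseteq> {j. a * u j \<in> B}" for i
    using au by auto
  moreover obtain i where "i \<in> I"
    using I unfolding directed_set_def by blast
  ultimately show "\<forall>\<^sub>F i in net_filter I le. a * u i \<in> B"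
    unfolding net_filter_def
    by (intro eventually_INF1 [of i]) (auto simp: eventually_principal)
  show "((\<lambda>i. a * u i) \<longlongrightarrow> a) (net_filter I le)"
    using u by (simp add: approximate_unit_def)
qed fact

theorem proposition9p8:
  fixes B :: "'a::cstar_algebra set"
    and I :: "'i set" and le :: "'i \<Rightarrow> 'i \<Rightarrow> bool" and u :: "'i \<Rightarrow> 'a"
  assumes "separable_space (euclidean :: 'a topology)"
    and "closed_star_subalgebra B"
    and "approximate_unit I le u" and "\<forall>i\<in>I. u i \<in> B"
    and "abelian B"
  shows "((\<forall>J \<phi>. virtual_commutant B J \<phi> \<longrightarrow> \<phi> ` J \<subseteq> B) \<longleftrightarrow> relative_commutant B \<subseteq> B) \<and>
         (relative_commutant B \<subseteq> B \<longleftrightarrow> maximal_abelian B)"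
proof (intro conjI iffI allI impI)
  assume vc: "\<forall>J \<phi>. virtual_commutant B J \<phi> \<longrightarrow> \<phi> ` J \<subseteq> B"
  show "relative_commutant B \<subseteq> B"
  proof
    fix a assume "a \<in> relative_commutant B"
    then have "(\<lambda>x. a * x) ` B \<subseteq> B"
      by (intro vc [rule_format] virtual_commutant_left_mult assms(2))
    \<comment> \<open>\<open>B\<close> may lack a unit, so \<open>a\<close> itself need not be a
      value of the multiplication map; the values at \<open>u i\<close> approximate it.\<close>
    then have "a * u i \<in> B" if "i \<in> I" for i
      using assms(4) that by blast
    moreover have "closed B"
      using assms(2) by (simp add: closed_star_subalgebra_def)
    ultimately show "a \<in> B"
      using mem_if_mult_approximate_unit_mem [OF assms(3)] by blast
  qed
next
  fix J \<phi> assume "relative_commutant B \<subseteq> B" "virtual_commutant B J \<phi>"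
  then show "\<phi> ` J \<subseteq> B"
    using virtual_commutant_range_subset_relative_commutant [OF assms(5)] by blast
next
  show "relative_commutant B \<subseteq> B \<Longrightarrow> maximal_abelian B"
    and "maximal_abelian B \<Longrightarrow> relative_commutant B \<subseteq> B"
    by (simp_all only: maximal_abelian_iff_relative_commutant_subset assms(2,5))
qed

end
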